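(* For every integer $k\geq 2$ and every $k$-graph $F$ we have $$M_F(n)\leq\big(\pi(F)+o(1)\big)\binom{n}{k},$$ that is, for every $\varepsilon>0$ there is $n_0$ such that $M_F(n)\leq(\pi(F)+\varepsilon)\binom{n}{k}$ for all integers $n\geq n_0$.
   Context: A $k$-graph $H$ consists of a vertex set $V(H)$ and an edge set $E(H)\subseteq V(H)^{(k)}$, where $V(H)^{(k)}$ is the set of $k$-element subsets of $V(H)$. A copy of $F$ in $H$ is a subhypergraph of $H$ isomorphic to $F$, and $c(F,H)$ is the number of copies. For $e\in V(H)^{(k)}$, $H\cup e=(V(H),E(H)\cup\{e\})$. The $F$-process starting with $H$ is the sequence $(H_i)_{i\geq 0}$ with $H_0=H$ and $H_{i+1}$ the $k$-graph on $V(H)$ with edge set $E(H_i)\cup\{e\in V(H)^{(k)}: c(F,H_i\cup e)>c(F,H_i)\}$. Its running time is $\tau_F(H)=\min\{t\in\mathbb{N}_{\geq0}: H_t=H_{t+1}\}$ and $M_F(n)=\max\{\tau_F(H): H \text{ a } k\text{-graph on } n \text{ vertices}\}$. The extremal number $\mathrm{ex}(n,F)$ is the maximum number of edges of an $F$-free $k$-graph on $n$ vertices, and the Turán density is $\pi(F)=\lim_{n\to\infty}\mathrm{ex}(n,F)/\binom{n}{k}$. *)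

theory Defs
  imports Complex_Main "HOL-Library.Ramsey"
begin

datatype 'a hypergraph = Hypergraph (verts: "'a set") (edges: "'a set set")

text \<open>\<open>[V]\<^bsup>k\<^esup>\<close> is the library notation for the set of \<open>k\<close>-element subsets of \<open>V\<close>.
  As usual in extremal combinatorics, all \<open>k\<close>-graphs are finite.\<close>

definition kgraph :: "nat \<Rightarrow> 'a hypergraph \<Rightarrow> bool" where
  "kgraph k H \<longleftrightarrow> finite (verts H) \<and> edges H \<subseteq> [verts H]\<^bsup>k\<^esup>"

definition subhypergraph :: "'a hypergraph \<Rightarrow> 'a hypergraph \<Rightarrow> bool" where
  "subhypergraph G H \<longleftrightarrow>
     verts G \<subseteq> verts H \<and> edges G \<subseteq> edges H \<and> edges G \<subseteq> Pow (verts G)"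

definition isomorphic :: "'a hypergraph \<Rightarrow> 'b hypergraph \<Rightarrow> bool" where
  "isomorphic G H \<longleftrightarrow>
     (\<exists>f. bij_betw f (verts G) (verts H) \<and> edges H = (\<lambda>e. f ` e) ` edges G)"

definition copies :: "'a hypergraph \<Rightarrow> 'b hypergraph \<Rightarrow> 'b hypergraph set" where
  "copies F H = {G. subhypergraph G H \<and> isomorphic F G}"

definition num_copies :: "'a hypergraph \<Rightarrow> 'b hypergraph \<Rightarrow> nat" where
  "num_copies F H = card (copies F H)"

definition add_edge :: "'a hypergraph \<Rightarrow> 'a set \<Rightarrow> 'a hypergraph" where
  "add_edge H e = Hypergraph (verts H) (edges H \<union> {e})"

text \<open>The uniformity \<open>k\<close> is an explicit parameter because an edgeless \<open>F\<close> does not determine it.\<close>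

definition process_step :: "nat \<Rightarrow> 'a hypergraph \<Rightarrow> 'b hypergraph \<Rightarrow> 'b hypergraph" where
  "process_step k F H = Hypergraph (verts H)
     (edges H \<union> {e \<in> [verts H]\<^bsup>k\<^esup>. num_copies F (add_edge H e) > num_copies F H})"

primrec process :: "nat \<Rightarrow> 'a hypergraph \<Rightarrow> 'b hypergraph \<Rightarrow> nat \<Rightarrow> 'b hypergraph" where
  "process k F H 0 = H"
| "process k F H (Suc i) = process_step k F (process k F H i)"

definition running_time :: "nat \<Rightarrow> 'a hypergraph \<Rightarrow> 'b hypergraph \<Rightarrow> nat" where
  "running_time k F H = (LEAST t. process k F H t = process k F H (Suc t))"

text \<open>Every finite \<open>k\<close>-graph is isomorphic to one whose vertices are natural numbers, so host
  graphs on \<open>n\<close> vertices are taken of type \<^typ>\<open>nat hypergraph\<close>.\<close>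

definition max_running_time :: "nat \<Rightarrow> 'a hypergraph \<Rightarrow> nat \<Rightarrow> nat" where
  "max_running_time k F n =
     Max {running_time k F H | H :: nat hypergraph. kgraph k H \<and> card (verts H) = n}"

definition free_of :: "'a hypergraph \<Rightarrow> 'b hypergraph \<Rightarrow> bool" where
  "free_of F H \<longleftrightarrow> copies F H = {}"

text \<open>On sets of natural numbers, \<open>Sup\<close> is the maximum of a finite nonempty set, and
  \<open>Sup {} = 0\<close>. The empty case arises only for an edgeless \<open>F\<close> with at most \<open>n\<close> vertices,
  where no \<open>F\<close>-free \<open>k\<close>-graph on \<open>n\<close> vertices exists; such an \<open>F\<close> thus has Turan density 0.\<close>

definition extremal_number :: "nat \<Rightarrow> nat \<Rightarrow> 'a hypergraph \<Rightarrow> nat" where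
  "extremal_number k n F =
     Sup {card (edges H) | H :: nat hypergraph. kgraph k H \<and> card (verts H) = n \<and> free_of F H}"

definition turan_density :: "nat \<Rightarrow> 'a hypergraph \<Rightarrow> real" where
  "turan_density k F = lim (\<lambda>n. real (extremal_number k n F) / real (n choose k))"

end

theory Submission imports Defs begin

text \<open>Pick one new edge \<open>e\<^sub>t\<close> from every step \<open>t\<close> of an \<open>F\<close>-process. A copy of \<open>F\<close> formed by such
  edges (the one of step \<open>0\<close> excluded) whose last edge is \<open>e\<^sub>t\<close> must contain \<open>e\<^sub>t\<^sub>-\<^sub>1\<close>, since otherwise
  \<open>e\<^sub>t\<close> would have been added one step earlier. Hence, for a set \<open>S\<close> of \<open>m\<close> vertices, the edges
  \<open>e\<^sub>t \<subseteq> S\<close> with \<open>\<not> e\<^sub>t\<^sub>-\<^sub>1 \<subseteq> S\<close> form an \<open>F\<close>-free graph, with at most \<open>ex(m, F)\<close> edges. Averaging over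
  all \<open>S\<close> for fixed \<open>m\<close> and large \<open>n\<close>, almost every pair \<open>e\<^sub>t \<subseteq> S\<close> is counted, as
  \<open>e\<^sub>t \<union> e\<^sub>t\<^sub>-\<^sub>1\<close> has more than \<open>k\<close> vertices; so the running time is at most
  \<open>(ex(m, F) / (m choose k) + o(1)) (n choose k)\<close>.\<close>

section \<open>Counting supersets and copies\<close>

lemma card_nsets_superset:
  assumes "finite V" "A \<subseteq> V" "card A \<le> m"
  shows "card {S \<in> [V]\<^bsup>m\<^esup>. A \<subseteq> S} = (card V - card A) choose (m - card A)"
proof -
  have fA: "finite A" using assms finite_subset by blast
  have "bij_betw (\<lambda>S. S - A) {S \<in> [V]\<^bsup>m\<^esup>. A \<subseteq> S} {B. B \<subseteq> V - A \<and> card B = m - card A}"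
  proof (rule bij_betw_byWitness[where f' = "\<lambda>B. B \<union> A"])
    show "(\<lambda>S. S - A) ` {S \<in> [V]\<^bsup>m\<^esup>. A \<subseteq> S} \<subseteq> {B. B \<subseteq> V - A \<and> card B = m - card A}"
      using fA by (auto simp: nsets_def card_Diff_subset)
    show "(\<lambda>B. B \<union> A) ` {B. B \<subseteq> V - A \<and> card B = m - card A} \<subseteq> {S \<in> [V]\<^bsup>m\<^esup>. A \<subseteq> S}"
    proof clarify
      fix B assume B: "B \<subseteq> V - A" "card B = m - card A"
      then have "finite B" using assms(1) finite_subset by blast
      moreover have "B \<inter> A = {}" using B by blast
      ultimately have "card (B \<union> A) = m"
        using B(2) fA assms(3) by (simp add: card_Un_disjoint)
      then show "B \<union> A \<in> [V]\<^bsup>m\<^esup> \<and> A \<subseteq> B \<union> A"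
        using B assms(2) \<open>finite B\<close> fA by (auto simp: nsets_def)
    qed
  qed auto
  then have "card {S \<in> [V]\<^bsup>m\<^esup>. A \<subseteq> S} = card {B. B \<subseteq> V - A \<and> card B = m - card A}"
    by (rule bij_betw_same_card)
  also have "\<dots> = card (V - A) choose (m - card A)"
    using assms(1) by (intro n_subsets) auto
  finally show ?thesis using fA assms by (simp add: card_Diff_subset)
qed

lemma finite_copies:
  assumes "finite (verts H)"
  shows "finite (copies F H)"
proof (rule finite_subset)
  show "copies F H \<subseteq> (\<lambda>(V, E). Hypergraph V E) ` (Pow (verts H) \<times> Pow (Pow (verts H)))"
  proof
    fix G assume "G \<in> copies F H"
    then have "(verts G, edges G) \<in> Pow (verts H) \<times> Pow (Pow (verts H))"
      by (auto simp: copies_def subhypergraph_def)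
    then have "(\<lambda>(V, E). Hypergraph V E) (verts G, edges G) \<in>
        (\<lambda>(V, E). Hypergraph V E) ` (Pow (verts H) \<times> Pow (Pow (verts H)))"
      by (rule imageI)
    then show "G \<in> (\<lambda>(V, E). Hypergraph V E) ` (Pow (verts H) \<times> Pow (Pow (verts H)))"
      by simp
  qed
qed (use assms in auto)

lemma copies_mono: "subhypergraph G H \<Longrightarrow> copies F G \<subseteq> copies F H"
  by (auto simp: copies_def subhypergraph_def)

text \<open>Old copies survive, and \<open>G\<close> is an additional one because it uses the absent
  edge \<open>e\<close>. Thus a single copy through \<open>e\<close> meets the criterion by which
  the process adds \<open>e\<close>.\<close>

lemma num_copies_add_edge:
  assumes "finite (verts H)" "G \<in> copies F (add_edge H e)" "e \<in> edges G" "e \<notin> edges H"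
  shows "num_copies F (add_edge H e) > num_copies F H"
proof -
  have "copies F H \<subseteq> copies F (add_edge H e)"
    by (auto simp: copies_def subhypergraph_def add_edge_def)
  moreover have "G \<notin> copies F H"
    using assms(3,4) by (auto simp: copies_def subhypergraph_def)
  ultimately have "copies F H \<subset> copies F (add_edge H e)" using assms(2) by blast
  moreover have "finite (copies F (add_edge H e))"
    using assms(1) by (intro finite_copies) (simp add: add_edge_def)
  ultimately show ?thesis unfolding num_copies_def by (intro psubset_card_mono)
qed

lemma isomorphic_edges_empty: "isomorphic F G \<Longrightarrow> edges G = {} \<longleftrightarrow> edges F = {}"
  by (auto simp: isomorphic_def)

section \<open>Extremal numbers and existence of the Turan density\<close>

lemma card_edges_le:
  assumes "kgraph k H"
  shows "card (edges H) \<le> card (verts H) choose k"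
  using assms card_mono[of "[verts H]\<^bsup>k\<^esup>" "edges H"]
  by (auto simp: kgraph_def card_nsets finite_imp_finite_nsets)

lemma card_edges_le_extremal_number:
  fixes H :: "nat hypergraph"
  assumes "kgraph k H" "free_of F H"
  shows "card (edges H) \<le> extremal_number k (card (verts H)) F"
  unfolding extremal_number_def
proof (rule cSup_upper)
  show "bdd_above {card (edges H') | H' :: nat hypergraph.
      kgraph k H' \<and> card (verts H') = card (verts H) \<and> free_of F H'}"
    using card_edges_le by (intro bdd_aboveI[where M = "card (verts H) choose k"]) fastforce
qed (use assms in auto)

lemma extremal_number_le:
  assumes "\<And>H :: nat hypergraph.
    kgraph k H \<Longrightarrow> card (verts H) = n \<Longrightarrow> free_of F H \<Longrightarrow> card (edges H) \<le> B"
  shows "extremal_number k n F \<le> B"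
proof (cases "{card (edges H) | H :: nat hypergraph.
    kgraph k H \<and> card (verts H) = n \<and> free_of F H} = {}")
  case True
  \<comment> \<open>The supremum of the empty set of naturals is \<open>0\<close>.\<close>
  then show ?thesis unfolding extremal_number_def by (simp only: Sup_nat_def) simp
next
  case False
  then show ?thesis unfolding extremal_number_def using assms by (intro cSup_least) auto
qed

lemma sum_card_flip:
  assumes "finite A" "finite B"
  shows "(\<Sum>a\<in>A. card {b \<in> B. R a b}) = (\<Sum>b\<in>B. card {a \<in> A. R a b})"
  using sum.swap_restrict[OF assms, of "\<lambda>_ _. 1 :: nat" R] by simp

text \<open>Double counting of pairs \<open>e \<subseteq> S\<close> with \<open>e\<close> an edge
  and \<open>S\<close> an \<open>m\<close>-set of vertices: each edge lies in
  \<open>(n - k) choose (m - k)\<close> such sets, and each \<open>S\<close> induces an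
  \<open>F\<close>-free graph.\<close>

lemma extremal_number_averaging:
  assumes "k \<le> m" "m \<le> n"
  shows "extremal_number k n F * ((n - k) choose (m - k)) \<le> (n choose m) * extremal_number k m F"
proof -
  \<comment> \<open>Integer division puts the bound into the form required by
    \<open>extremal_number_le\<close>; as the divisor is positive, it is equivalent to the product
    form.\<close>
  have "card (edges H) \<le> (n choose m) * extremal_number k m F div ((n - k) choose (m - k))"
    if H: "kgraph k H" "card (verts H) = n" "free_of F H" for H :: "nat hypergraph"
  proof -
    have fV: "finite (verts H)" and E: "edges H \<subseteq> [verts H]\<^bsup>k\<^esup>"
      using H(1) by (auto simp: kgraph_def)
    have fE: "finite (edges H)" using fV E finite_imp_finite_nsets finite_subset by blast
    have fS: "finite ([verts H]\<^bsup>m\<^esup>)" using fV by (rule finite_imp_finite_nsets)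
    have "card (edges H) * ((n - k) choose (m - k)) = (\<Sum>e\<in>edges H. card {S \<in> [verts H]\<^bsup>m\<^esup>. e \<subseteq> S})"
    proof -
      have "card {S \<in> [verts H]\<^bsup>m\<^esup>. e \<subseteq> S} = (n - k) choose (m - k)" if "e \<in> edges H" for e
        using card_nsets_superset[OF fV, of e m] that E H(2) assms(1) by (auto simp: nsets_def)
      then show ?thesis by simp
    qed
    also have "\<dots> = (\<Sum>S\<in>[verts H]\<^bsup>m\<^esup>. card {e \<in> edges H. e \<subseteq> S})"
      using fE fS by (rule sum_card_flip)
    also have "\<dots> \<le> (\<Sum>S\<in>[verts H]\<^bsup>m\<^esup>. extremal_number k m F)"
    proof (rule sum_mono)
      fix S assume S: "S \<in> [verts H]\<^bsup>m\<^esup>"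
      let ?G = "Hypergraph S {e \<in> edges H. e \<subseteq> S}"
      have "kgraph k ?G" using S E by (auto simp: kgraph_def nsets_def)
      moreover have "free_of F ?G"
      proof -
        have "subhypergraph ?G H" using S by (auto simp: subhypergraph_def nsets_def)
        then show ?thesis using copies_mono[of ?G H F] H(3) by (auto simp: free_of_def)
      qed
      ultimately have "card (edges ?G) \<le> extremal_number k (card (verts ?G)) F"
        by (rule card_edges_le_extremal_number)
      then show "card {e \<in> edges H. e \<subseteq> S} \<le> extremal_number k m F"
        using S by (simp add: nsets_def)
    qed
    also have "\<dots> = (n choose m) * extremal_number k m F"
      using H(2) by (simp add: card_nsets)
    finally show ?thesis using assms by (simp add: less_eq_div_iff_mult_less_eq)
  qed
  then have "extremal_number k n F \<le> (n choose m) * extremal_number k m F div ((n - k) choose (m - k))"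
    by (rule extremal_number_le)
  then show ?thesis using assms by (simp add: less_eq_div_iff_mult_less_eq)
qed

text \<open>Follows from averaging by \<open>(n choose m) * (m choose k) = (n choose k) * ((n - k)
  choose (m - k))\<close>, after which the last factor cancels.\<close>

lemma turan_ratio_antimono:
  assumes "k \<le> m" "m \<le> n"
  shows "real (extremal_number k n F) / real (n choose k)
    \<le> real (extremal_number k m F) / real (m choose k)"
proof -
  let ?c = "(n - k) choose (m - k)"
  have pos: "?c > 0" "n choose k > 0" "m choose k > 0" using assms by auto
  have "extremal_number k n F * (m choose k) * ?c
      \<le> (n choose m) * extremal_number k m F * (m choose k)"
    using mult_right_mono[OF extremal_number_averaging[OF assms, of F], of "m choose k"]
    by (simp add: ac_simps)
  also have "\<dots> = extremal_number k m F * (n choose k) * ?c"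
    using choose_mult[OF assms] by (simp add: ac_simps)
  finally have "extremal_number k n F * (m choose k) \<le> extremal_number k m F * (n choose k)"
    using pos by simp
  then have "real (extremal_number k n F) * real (m choose k)
      \<le> real (extremal_number k m F) * real (n choose k)"
    by (simp flip: of_nat_mult)
  then show ?thesis using pos by (simp add: field_simps)
qed

text \<open>The density is defined by \<open>lim\<close>, which is informative only once convergence
  is known. The ratios are nonnegative and eventually nonincreasing.\<close>

lemma turan_density_tendsto:
  "(\<lambda>n. real (extremal_number k n F) / real (n choose k)) \<longlonglongrightarrow> turan_density k F"
proof -
  let ?a = "\<lambda>n. real (extremal_number k n F) / real (n choose k)"
  \<comment> \<open>The shift skips \<open>n < k\<close>, where the denominator and hence the ratio
    is \<open>0\<close>, which would break monotonicity.\<close>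
  have "decseq (\<lambda>n. ?a (n + k))" by (auto simp: decseq_def intro: turan_ratio_antimono)
  then obtain L where "(\<lambda>n. ?a (n + k)) \<longlonglongrightarrow> L"
    by (rule decseq_convergent[where B = 0]) auto
  then have "convergent (\<lambda>n. ?a (n + k))" by (rule convergentI)
  then have "convergent ?a" by (subst (asm) convergent_ignore_initial_segment)
  then show ?thesis by (simp add: convergent_LIMSEQ_iff turan_density_def)
qed

section \<open>New edges along the process and the running time\<close>

lemma verts_process [simp]: "verts (process k F H i) = verts H"
  by (induction i) (auto simp: process_step_def)

lemma edges_process_mono: "i \<le> j \<Longrightarrow> edges (process k F H i) \<subseteq> edges (process k F H j)"
  by (rule lift_Suc_mono_le[of "\<lambda>i. edges (process k F H i)"]) (auto simp: process_step_def)

lemma exists_new_edge: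
  assumes "t < running_time k F H"
  obtains e where "e \<in> edges (process k F H (Suc t))" "e \<notin> edges (process k F H t)"
proof -
  have "process k F H t \<noteq> process k F H (Suc t)"
    using not_less_Least assms unfolding running_time_def by blast
  then have "edges (process k F H t) \<noteq> edges (process k F H (Suc t))"
    using verts_process by (metis hypergraph.expand)
  then show thesis using edges_process_mono[OF le_SucI[OF order_refl], of k F H t] that by blast
qed

lemma new_edge_copies:
  assumes "e \<in> edges (process k F H (Suc t))" "e \<notin> edges (process k F H t)"
  shows "e \<in> [verts H]\<^bsup>k\<^esup>"
    and "num_copies F (add_edge (process k F H t) e) > num_copies F (process k F H t)"
  using assms by (auto simp: process_step_def)

text \<open>Copies of an edgeless \<open>F\<close> contain no edge, so no added edge creates one.
  The case is separate because the main argument looks at the last edge of a copy.\<close>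

lemma running_time_edgeless:
  assumes "edges F = {}"
  shows "running_time k F H = 0"
proof (rule ccontr)
  assume "running_time k F H \<noteq> 0"
  then obtain e where e: "e \<in> edges (process k F H (Suc 0))" "e \<notin> edges (process k F H 0)"
    by (metis exists_new_edge neq0_conv)
  have "copies F (add_edge H e) = copies F H"
    using assms isomorphic_edges_empty
    by (fastforce simp: copies_def subhypergraph_def add_edge_def)
  then show False using new_edge_copies(2)[OF e] by (simp add: num_copies_def)
qed

lemma free_of_new_edges:
  assumes "edges F \<noteq> {}" "finite (verts H)" "S \<subseteq> verts H"
    and new: "\<And>t. t < T \<Longrightarrow> e t \<in> edges (process k F H (Suc t)) \<and> e t \<notin> edges (process k F H t)"
  shows "free_of F (Hypergraph S (e ` {t \<in> {1..<T}. e t \<subseteq> S \<and> \<not> e (t - 1) \<subseteq> S}))"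
proof -
  let ?J = "{t \<in> {1..<T}. e t \<subseteq> S \<and> \<not> e (t - 1) \<subseteq> S}"
  have False if G: "G \<in> copies F (Hypergraph S (e ` ?J))" for G
  proof -
    define K where "K = {t \<in> ?J. e t \<in> edges G}"
    have GE: "edges G \<subseteq> e ` ?J" "verts G \<subseteq> S" "edges G \<subseteq> Pow (verts G)" "isomorphic F G"
      using G by (auto simp: copies_def subhypergraph_def)
    have "edges G \<noteq> {}" using GE(4) assms(1) isomorphic_edges_empty by blast
    then have K: "finite K" "K \<noteq> {}" using GE(1) by (auto simp: K_def)
    \<comment> \<open>\<open>e t\<close> is the edge of \<open>G\<close> that the process adds last;
      it turns out to have been eligible one step earlier.\<close>
    define t where "t = Max K"
    have t: "t \<in> K" "\<And>s. s \<in> K \<Longrightarrow> s \<le> t" using K by (auto simp: t_def)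
    then have tJ: "1 \<le> t" "t < T" "\<not> e (t - 1) \<subseteq> S" "e t \<in> edges G" by (auto simp: K_def)
    let ?P = "process k F H (t - 1)"
    have "edges G \<subseteq> edges (add_edge ?P (e t))"
    proof
      fix f assume f: "f \<in> edges G"
      then obtain s where s: "s \<in> K" "f = e s" using GE(1) unfolding K_def by blast
      show "f \<in> edges (add_edge ?P (e t))"
      proof (cases "s = t")
        case False
        \<comment> \<open>All edges of \<open>G\<close> lie inside \<open>S\<close>, but
          \<open>e (t - 1)\<close> does not. So every other edge of \<open>G\<close> has index at
          most \<open>t - 2\<close> and is present at time \<open>t - 1\<close>.\<close>
        have "s \<noteq> t - 1" using s(1) tJ(3) by (auto simp: K_def)
        then have "Suc s \<le> t - 1" using t(2)[OF s(1)] False by simp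
        then have "edges (process k F H (Suc s)) \<subseteq> edges ?P" by (rule edges_process_mono)
        then show ?thesis using new[of s] s by (auto simp: K_def add_edge_def)
      qed (simp add: s add_edge_def)
    qed
    then have "G \<in> copies F (add_edge ?P (e t))"
      using GE assms(3) by (auto simp: copies_def subhypergraph_def add_edge_def)
    moreover have "e t \<notin> edges ?P"
      using new[OF tJ(2)] edges_process_mono[of "t - 1" t k F H] by auto
    ultimately have "num_copies F (add_edge ?P (e t)) > num_copies F ?P"
      using num_copies_add_edge[of ?P] assms(2) tJ(4) by simp
    moreover have "e t \<in> [verts H]\<^bsup>k\<^esup>" using new[OF tJ(2)] new_edge_copies(1) by blast
    \<comment> \<open>As \<open>t \<ge> 1\<close>, this is the graph at time \<open>t\<close>, in
      which \<open>e t\<close> must still be missing.\<close>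
    ultimately have "e t \<in> edges (process k F H (Suc (t - 1)))"
      by (simp add: process_step_def)
    then show False using new[OF tJ(2)] tJ(1) by simp
  qed
  then show ?thesis by (auto simp: free_of_def)
qed

text \<open>Double counting of pairs of an index \<open>t \<ge> 1\<close> and an
  \<open>m\<close>-set \<open>S\<close> with \<open>e t \<subseteq> S\<close> and not
  \<open>e (t - 1) \<subseteq> S\<close>. The first \<open>- 1\<close> discards index
  \<open>0\<close>, which has no predecessor; the one in the binomial comes from forbidding a vertex
  of \<open>e (t - 1)\<close>.\<close>

lemma running_time_averaging:
  fixes H :: "nat hypergraph"
  assumes "edges F \<noteq> {}" "kgraph k H" "card (verts H) = n" "k \<le> m" "m < n"
  shows "(running_time k F H - 1) * ((n - 1 - k) choose (m - k))
    \<le> (n choose m) * extremal_number k m F"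
proof -
  define T where "T = running_time k F H"
  have fV: "finite (verts H)" using assms(2) by (simp add: kgraph_def)
  have "\<exists>e. \<forall>t<T. e t \<in> edges (process k F H (Suc t)) \<and> e t \<notin> edges (process k F H t)"
    unfolding T_def by (metis exists_new_edge)
  then obtain e where
    new: "\<And>t. t < T \<Longrightarrow> e t \<in> edges (process k F H (Suc t)) \<and> e t \<notin> edges (process k F H t)"
    by blast
  have eV: "e t \<in> [verts H]\<^bsup>k\<^esup>" if "t < T" for t
    using new[OF that] new_edge_copies(1) by blast
  \<comment> \<open>\<open>e s\<close> is present from time \<open>Suc s\<close> on, so it cannot be
    new at a later step.\<close>
  have neq: "e s \<noteq> e t" if "s < t" "t < T" for s t
    using new[of s] new[of t] edges_process_mono[of "Suc s" t k F H] that by force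
  then have inj: "inj_on e {..<T}"
    by (intro linorder_inj_onI) auto
  let ?R = "\<lambda>t S. e t \<subseteq> S \<and> \<not> e (t - 1) \<subseteq> S"
  have fS: "finite ([verts H]\<^bsup>m\<^esup>)" using fV by (rule finite_imp_finite_nsets)
  have "(T - 1) * ((n - 1 - k) choose (m - k)) = (\<Sum>t\<in>{1..<T}. (n - 1 - k) choose (m - k))"
    by simp
  also have "\<dots> \<le> (\<Sum>t\<in>{1..<T}. card {S \<in> [verts H]\<^bsup>m\<^esup>. ?R t S})"
  proof (rule sum_mono)
    fix t assume t: "t \<in> {1..<T}"
    have "\<not> e (t - 1) \<subseteq> e t"
    proof
      assume "e (t - 1) \<subseteq> e t"
      moreover have "card (e (t - 1)) = card (e t)" "finite (e t)"
        using eV[of t] eV[of "t - 1"] t by (auto simp: nsets_def)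
      ultimately have "e (t - 1) = e t" by (simp add: card_subset_eq)
      then show False using neq[of "t - 1" t] t by auto
    qed
    then obtain x where x: "x \<in> e (t - 1)" "x \<notin> e t" by blast
    have xV: "x \<in> verts H" using x(1) eV[of "t - 1"] t by (force simp: nsets_def)
    have et: "e t \<subseteq> verts H - {x}" "card (e t) = k"
      using eV[of t] t x(2) by (auto simp: nsets_def)
    \<comment> \<open>Avoiding the single vertex \<open>x\<close> already prevents
      \<open>e (t - 1) \<subseteq> S\<close>, which suffices for a lower bound.\<close>
    have "(n - 1 - k) choose (m - k) = card {S \<in> [verts H - {x}]\<^bsup>m\<^esup>. e t \<subseteq> S}"
      using card_nsets_superset[of "verts H - {x}" "e t" m] fV et assms(3,4) xV by simp
    also have "\<dots> \<le> card {S \<in> [verts H]\<^bsup>m\<^esup>. ?R t S}"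
      using fS x(1) by (intro card_mono finite_Collect_conjI) (auto simp: nsets_def)
    finally show "(n - 1 - k) choose (m - k) \<le> card {S \<in> [verts H]\<^bsup>m\<^esup>. ?R t S}" .
  qed
  also have "\<dots> = (\<Sum>S\<in>[verts H]\<^bsup>m\<^esup>. card {t \<in> {1..<T}. ?R t S})"
    using fS by (intro sum_card_flip) auto
  also have "\<dots> \<le> (\<Sum>S\<in>[verts H]\<^bsup>m\<^esup>. extremal_number k m F)"
  proof (rule sum_mono)
    fix S assume S: "S \<in> [verts H]\<^bsup>m\<^esup>"
    let ?J = "{t \<in> {1..<T}. ?R t S}"
    let ?G = "Hypergraph S (e ` ?J)"
    have "kgraph k ?G" using S eV by (auto simp: kgraph_def nsets_def)
    moreover have "free_of F ?G"
      using free_of_new_edges[OF assms(1) fV _ new] S by (simp add: nsets_def)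
    ultimately have "card (edges ?G) \<le> extremal_number k (card (verts ?G)) F"
      by (rule card_edges_le_extremal_number)
    \<comment> \<open>Injectivity turns the bound on edges into a bound on indices.\<close>
    moreover have "card (e ` ?J) = card ?J"
      using inj by (intro card_image inj_on_subset[OF inj]) auto
    ultimately show "card ?J \<le> extremal_number k m F" using S by (simp add: nsets_def)
  qed
  also have "\<dots> = (n choose m) * extremal_number k m F"
    using assms(3) by (simp add: card_nsets)
  finally show ?thesis by (simp add: T_def)
qed

text \<open>The summand \<open>1\<close> accounts for index \<open>0\<close>. The factor
  \<open>(n - k) / (n - m)\<close> is the quotient of \<open>(n - k) choose (m - k)\<close> by
  \<open>(n - 1 - k) choose (m - k)\<close>, the cost of avoiding one vertex.\<close>

lemma running_time_bound:
  fixes H :: "nat hypergraph"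
  assumes "kgraph k H" "card (verts H) = n" "k \<le> m" "m < n"
  shows "real (running_time k F H) \<le> 1 +
    real (extremal_number k m F) / real (m choose k) * (real (n - k) / real (n - m)) * real (n choose k)"
proof (cases "edges F = {}")
  case True
  then show ?thesis by (simp add: running_time_edgeless)
next
  case False
  \<comment> \<open>Truncated subtraction: a running time of \<open>0\<close> also satisfies the
    final bound by \<open>1 + x\<close>.\<close>
  define x where "x = running_time k F H - 1"
  let ?c = "(n - 1 - k) choose (m - k)" and ?d = "(n - k) choose (m - k)"
  have pos: "?c > 0" "m choose k > 0" "n - m > 0" using assms by auto
  have cd: "(n - k) * ?c = (n - m) * ?d"
    using binomial_absorb_comp[of "n - k" "m - k"] assms by (simp add: diff_commute)
  \<comment> \<open>The extra factors prepare for \<open>choose_mult\<close> and \<open>cd\<close>,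
    which make \<open>?c\<close> common to both sides.\<close>
  have "x * (m choose k) * (n - m) * ?c \<le> (n choose m) * extremal_number k m F * (m choose k) * (n - m)"
    using mult_right_mono[OF running_time_averaging[OF False assms], of "(m choose k) * (n - m)"]
    by (simp add: x_def ac_simps)
  also have "\<dots> = extremal_number k m F * (n choose k) * ((n - m) * ?d)"
    using choose_mult[of k m n] assms by (simp add: ac_simps)
  also have "\<dots> = extremal_number k m F * (n choose k) * (n - k) * ?c"
    by (simp flip: cd add: ac_simps)
  finally have "x * (m choose k) * (n - m) \<le> extremal_number k m F * (n choose k) * (n - k)"
    using pos by simp
  then have "real x * real (m choose k) * real (n - m)
      \<le> real (extremal_number k m F) * real (n choose k) * real (n - k)"
    by (simp only: of_nat_le_iff flip: of_nat_mult)
  then have "real x \<le>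
      real (extremal_number k m F) / real (m choose k) * (real (n - k) / real (n - m)) * real (n choose k)"
    using pos by (simp add: field_simps del: of_nat_diff)
  moreover have "real (running_time k F H) \<le> 1 + real x" by (simp add: x_def)
  ultimately show ?thesis by (meson add_left_mono order_trans)
qed

section \<open>The maximum over all host graphs and the limit\<close>

lemma max_running_time_le:
  assumes "\<And>H :: nat hypergraph.
    kgraph k H \<Longrightarrow> card (verts H) = n \<Longrightarrow> real (running_time k F H) \<le> B"
  shows "real (max_running_time k F n) \<le> B"
proof -
  let ?X = "{running_time k F H | H :: nat hypergraph. kgraph k H \<and> card (verts H) = n}"
  \<comment> \<open>There are infinitely many host graphs on natural numbers, so finiteness of the
    set of running times, needed for \<open>Max\<close>, comes from the uniform bound
    \<open>B\<close>.\<close>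
  have "?X \<subseteq> {..nat \<lfloor>B\<rfloor>}" using assms by (auto simp: le_nat_floor)
  then have "finite ?X" by (rule finite_subset) simp
  moreover have "?X \<noteq> {}"
  proof -
    have "kgraph k (Hypergraph {..<n} {})" "card (verts (Hypergraph {..<n} {})) = n"
      by (auto simp: kgraph_def)
    then show ?thesis by blast
  qed
  ultimately have "Max ?X \<in> ?X" by (rule Max_in)
  then show ?thesis unfolding max_running_time_def using assms by auto
qed

theorem theorem3p1:
  fixes k :: nat and F :: "'a hypergraph"
  assumes "k \<ge> 2" and "kgraph k F"
  shows "\<forall>\<epsilon>::real. \<epsilon> > 0 \<longrightarrow> (\<exists>n0. \<forall>n\<ge>n0.
    real (max_running_time k F n) \<le> (turan_density k F + \<epsilon>) * real (n choose k))"
proof (intro allI impI)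
  fix \<epsilon> :: real assume \<epsilon>: "\<epsilon> > 0"
  let ?a = "\<lambda>n. real (extremal_number k n F) / real (n choose k)"
  have "eventually (\<lambda>m. ?a m < turan_density k F + \<epsilon>) sequentially"
    by (rule order_tendstoD(2)[OF turan_density_tendsto]) (use \<epsilon> in simp)
  then have "eventually (\<lambda>m. ?a m < turan_density k F + \<epsilon> \<and> m \<ge> k) sequentially"
    using eventually_ge_at_top by (rule eventually_conj)
  \<comment> \<open>This \<open>m\<close> stays fixed while \<open>n\<close> tends to
    infinity.\<close>
  then obtain m where m: "?a m < turan_density k F + \<epsilon>" "m \<ge> k"
    using eventually_happens trivial_limit_sequentially by blast
  have quot: "(\<lambda>n. real (n - k) / real (n - m)) \<longlonglongrightarrow> 1"
  proof -
    have "filterlim (\<lambda>n. real (n - m)) at_top sequentially"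
      by (rule filterlim_compose[OF filterlim_real_sequentially filterlim_minus_const_nat_at_top])
    then have "(\<lambda>n. 1 + real (m - k) / real (n - m)) \<longlonglongrightarrow> 1 + 0"
      by (intro tendsto_add tendsto_const real_tendsto_divide_at_top[OF tendsto_const])
    moreover have "eventually (\<lambda>n. 1 + real (m - k) / real (n - m) = real (n - k) / real (n - m)) sequentially"
      using eventually_gt_at_top[of m] by eventually_elim (use m(2) in \<open>simp add: field_simps\<close>)
    ultimately show ?thesis using tendsto_cong by force
  qed
  have choose: "filterlim (\<lambda>n. real (n choose k)) at_top sequentially"
  proof (rule filterlim_at_top_mono)
    show "filterlim (\<lambda>n. real n / real k) at_top sequentially"
      using assms(1) unfolding divide_inverse mult.commute[of _ "inverse _"]
      by (intro filterlim_tendsto_pos_mult_at_top[OF tendsto_const _ filterlim_real_sequentially]) simp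
    show "eventually (\<lambda>n. real n / real k \<le> real (n choose k)) sequentially"
      using eventually_ge_at_top[of k]
    proof eventually_elim
      case (elim n)
      \<comment> \<open>The base is at least \<open>1\<close> because \<open>n \<ge> k\<close>, and
        \<open>(n / k) ^ k\<close> is a lower bound for \<open>n choose k\<close>.\<close>
      have "real n / real k \<le> (real n / real k) ^ k"
        using elim assms(1) by (intro self_le_power) auto
      then show ?case using binomial_ge_n_over_k_pow_k[OF elim, where 'a = real] by simp
    qed
  qed
  \<comment> \<open>This is the bound on the running time divided by \<open>n choose k\<close>; its
    limit \<open>?a m\<close> lies strictly below the target.\<close>
  have "(\<lambda>n. 1 / real (n choose k) + ?a m * (real (n - k) / real (n - m))) \<longlonglongrightarrow> 0 + ?a m * 1"
    by (intro tendsto_add tendsto_mult quot tendsto_const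
        real_tendsto_divide_at_top[OF tendsto_const choose])
  then have "eventually (\<lambda>n. 1 / real (n choose k) + ?a m * (real (n - k) / real (n - m))
      < turan_density k F + \<epsilon>) sequentially"
    using m(1) by (intro order_tendstoD(2)) auto
  then have "eventually (\<lambda>n. real (max_running_time k F n)
      \<le> (turan_density k F + \<epsilon>) * real (n choose k)) sequentially"
    using eventually_gt_at_top[of m]
  proof eventually_elim
    case (elim n)
    have c: "real (n choose k) > 0" using elim(2) m(2) by simp
    have "1 + ?a m * (real (n - k) / real (n - m)) * real (n choose k)
        = (1 / real (n choose k) + ?a m * (real (n - k) / real (n - m))) * real (n choose k)"
      using c by (simp add: distrib_right del: of_nat_diff)
    also have "\<dots> \<le> (turan_density k F + \<epsilon>) * real (n choose k)"
      using elim(1) c by (intro mult_right_mono) auto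
    finally show ?case
      by (intro max_running_time_le order_trans[OF running_time_bound[OF _ _ m(2) elim(2)]])
  qed
  then show "\<exists>n0. \<forall>n\<ge>n0. real (max_running_time k F n)
      \<le> (turan_density k F + \<epsilon>) * real (n choose k)"
    by (simp add: eventually_sequentially)
qed

end
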